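(* Let $\mathbb{F}$ be an arbitrary field, let $s,n\geq 1$ be integers, let $\sigma\in\{1,-1\}$, and let $\lambda B+A$ be an arbitrary matrix pencil of size $(s+1)n\times(s+1)n$ over $\mathbb{F}$. Then the pencil $$\mathcal{L}(\lambda)=\begin{bmatrix}\lambda B+A & L_s(\lambda)^T\otimes I_n\\ \sigma L_s(\lambda)\otimes I_n & 0\end{bmatrix}$$ is a strong linearization of the matrix polynomial $$P(\lambda)=(\Lambda_s(\lambda)^T\otimes I_n)(\lambda B+A)(\Lambda_s(\lambda)\otimes I_n)\in\mathbb{F}[\lambda]^{n\times n},$$ considered as a matrix polynomial of grade $2s+1$.
   Context: For $k\ge 1$, $L_k(\lambda)\in\mathbb{F}[\lambda]^{k\times(k+1)}$ is the matrix with $-1$ in the $(i,i)$ entries, $\lambda$ in the $(i,i+1)$ entries ($i=1,\dots,k$), and zeros elsewhere; $\Lambda_k(\lambda)^T=\begin{bmatrix}\lambda^k&\cdots&\lambda&1\end{bmatrix}$. For an integer $g\ge\deg P$, one may regard $P(\lambda)$ as having grade $g$ by allowing zero leading coefficients; its $g$-reversal is $\mathrm{rev}_g P(\lambda)=\lambda^gP(\lambda^{-1})$. A pencil $L(\lambda)=\lambda X+Y$ is a linearization of a matrix polynomial $P(\lambda)$ if there exist unimodular matrix polynomials $U(\lambda),V(\lambda)$ (i.e. square with nonzero constant determinant) with $U(\lambda)L(\lambda)V(\lambda)=\mathrm{diag}(I_m,P(\lambda))$ for some natural number $m$. It is a strong linearization of $P(\lambda)$ considered with grade $g$ if, in addition,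 $\mathrm{rev}_1L(\lambda)=\lambda Y+X$ is a linearization of $\mathrm{rev}_gP(\lambda)$. *)

theory Defs
  imports
    "Jordan_Normal_Form.Determinant"
    "HOL-Computational_Algebra.Polynomial"
begin

text \<open>
  A matrix polynomial over a field is a matrix with polynomial entries, of type
  \<^typ>\<open>'a poly mat\<close>; the indeterminate is \<^term>\<open>[:0, 1:]\<close>. Matrix indices start at 0.
\<close>

definition kron :: "'a :: semiring_0 mat \<Rightarrow> 'a mat \<Rightarrow> 'a mat" where
  "kron A B = mat (dim_row A * dim_row B) (dim_col A * dim_col B)
     (\<lambda>(i, j). A $$ (i div dim_row B, j div dim_col B) * B $$ (i mod dim_row B, j mod dim_col B))"

definition pencil :: "'a :: field mat \<Rightarrow> 'a mat \<Rightarrow> 'a poly mat" where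
  "pencil X Y = [:0, 1:] \<cdot>\<^sub>m map_mat (\<lambda>a. [:a:]) X + map_mat (\<lambda>a. [:a:]) Y"

definition is_pencil :: "'a :: field poly mat \<Rightarrow> bool" where
  "is_pencil L \<longleftrightarrow>
     (\<exists>X \<in> carrier_mat (dim_row L) (dim_col L). \<exists>Y \<in> carrier_mat (dim_row L) (dim_col L).
        L = pencil X Y)"

definition unimodular :: "'a :: field poly mat \<Rightarrow> bool" where
  "unimodular U \<longleftrightarrow> square_mat U \<and> (\<exists>c. c \<noteq> 0 \<and> det U = [:c:])"

definition has_grade :: "nat \<Rightarrow> 'a :: field poly mat \<Rightarrow> bool" where
  "has_grade g P \<longleftrightarrow> (\<forall>i < dim_row P. \<forall>j < dim_col P. degree (P $$ (i, j)) \<le> g)"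

text \<open>
  The reversal \<open>\<lambda>\<^sup>g p(\<lambda>\<^sup>-\<^sup>1)\<close>, meaningful when \<open>degree p \<le> g\<close>: the coefficient of \<open>\<lambda>\<^sup>i\<close> moves to
  \<open>\<lambda>\<^sup>g\<^sup>-\<^sup>i\<close>.
\<close>

definition rev_poly :: "nat \<Rightarrow> 'a :: field poly \<Rightarrow> 'a poly" where
  "rev_poly g p = (\<Sum>i\<le>g. monom (coeff p i) (g - i))"

definition rev_mat :: "nat \<Rightarrow> 'a :: field poly mat \<Rightarrow> 'a poly mat" where
  "rev_mat g P = map_mat (rev_poly g) P"

lemma poly_rev_poly:
  assumes "degree p \<le> g" and "x \<noteq> 0"
  shows "poly (rev_poly g p) x = x ^ g * poly p (inverse x)"
proof -
  have "x ^ g * poly p (inverse x) = x ^ g * (\<Sum>i\<le>g. coeff p i * inverse x ^ i)"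
    unfolding poly_altdef using assms(1)
    by (intro arg_cong[of _ _ "(*) _"] sum.mono_neutral_left) (auto simp: not_le coeff_eq_0)
  also have "\<dots> = (\<Sum>i\<le>g. coeff p i * x ^ (g - i))"
    unfolding sum_distrib_left using assms(2)
    by (intro sum.cong) (auto simp: power_diff power_inverse divide_inverse)
  finally show ?thesis
    by (simp add: rev_poly_def poly_sum poly_monom)
qed

lemma rev_mat_pencil:
  assumes "X \<in> carrier_mat r c" and "Y \<in> carrier_mat r c"
  shows "rev_mat 1 (pencil X Y) = pencil Y X"
  using assms by (intro eq_matI) (auto simp: rev_mat_def pencil_def rev_poly_def monom_0 monom_Suc)

definition is_linearization :: "'a :: field poly mat \<Rightarrow> 'a poly mat \<Rightarrow> bool" where
  "is_linearization L P \<longleftrightarrow> is_pencil L \<and>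
     (\<exists>m U V. U \<in> carrier_mat (dim_row L) (dim_row L) \<and> unimodular U \<and>
        V \<in> carrier_mat (dim_col L) (dim_col L) \<and> unimodular V \<and>
        U * L * V = diag_block_mat [1\<^sub>m m, P])"

definition is_strong_linearization :: "'a :: field poly mat \<Rightarrow> 'a poly mat \<Rightarrow> nat \<Rightarrow> bool" where
  "is_strong_linearization L P g \<longleftrightarrow> has_grade g P \<and>
     is_linearization L P \<and> is_linearization (rev_mat 1 L) (rev_mat g P)"

definition L_mat :: "nat \<Rightarrow> 'a :: field poly mat" where
  "L_mat k = mat k (k + 1) (\<lambda>(i, j). if j = i then -1 else if j = i + 1 then [:0, 1:] else 0)"

definition Lambda_mat :: "nat \<Rightarrow> 'a :: field poly mat" where
  "Lambda_mat k = mat (k + 1) 1 (\<lambda>(i, j). monom 1 (k - i))"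

end

theory Submission
  imports Defs
begin

text \<open>
  Write \<open>K = L\<^sub>s \<otimes> I\<^sub>n\<close> and \<open>N = \<Lambda>\<^sub>s \<otimes> I\<^sub>n\<close>, so \<open>K N = 0\<close>. There are constant-determinant
  completions: \<open>R\<close> and \<open>S\<close> such that \<open>[K; S]\<close> is a left inverse of \<open>[R, N]\<close>. In the basis given
  by \<open>[R, N]\<close> the blocks \<open>K\<close> and \<open>K\<^sup>T\<close> become \<open>[I, 0]\<close> and \<open>[I; 0]\<close>; these identity blocks eliminate
  everything of \<open>\<lambda>B + A\<close> except its compression \<open>N\<^sup>T (\<lambda>B + A) N\<close>. Reversal is multiplicative
  with respect to grades, so the reversed pencil has the same shape with \<open>rev\<^sub>1 K\<close> and \<open>rev\<^sub>s N\<close>,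
  which are complemented in the same way from the opposite end.
\<close>

section \<open>Unimodularity and products of matrices and blocks\<close>

text \<open>The determinants multiply to 1, so both are units of the polynomial ring, that is,
  nonzero constants. An explicit inverse on either side thus replaces computing a
  determinant.\<close>

lemma unimodular_if_mult_eq_one:
  fixes U V :: "'a :: field poly mat"
  assumes "U \<in> carrier_mat k k" "V \<in> carrier_mat k k" "U * V = 1\<^sub>m k"
  shows "unimodular U" "unimodular V"
proof -
  have eq: "det U * det V = 1"
    using assms by (metis det_mult det_one)
  then have "det U dvd 1" "det V dvd 1"
    by (metis dvd_triv_left, metis dvd_triv_right)
  then show "unimodular U" "unimodular V"
    using assms(1,2) unfolding unimodular_def
    by (auto simp: is_unit_poly_iff)
qed

text \<open>
  The library states these laws with \<^const>\<open>carrier_mat\<close> premises, where the inner dimension occurs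
  only in the premises, so the simplifier cannot use them on nested products. Premises about
  \<^const>\<open>dim_row\<close> and \<^const>\<open>dim_col\<close> can be discharged by rewriting.
\<close>

lemma mult_mat_assoc_dim:
  fixes A B C :: "'a :: semiring_0 mat"
  assumes "dim_col A = dim_row B" "dim_col B = dim_row C"
  shows "A * B * C = A * (B * C)"
  using assms by (intro assoc_mult_mat) (auto intro: carrier_matI)

lemma add_mult_distrib_mat_dim:
  fixes A B C :: "'a :: semiring_0 mat"
  assumes "dim_row A = dim_row B" "dim_col A = dim_col B" "dim_col B = dim_row C"
  shows "(A + B) * C = A * C + B * C"
  using assms by (intro add_mult_distrib_mat) (auto intro: carrier_matI)

lemma mult_add_distrib_mat_dim:
  fixes A B C :: "'a :: semiring_0 mat"
  assumes "dim_row B = dim_row C" "dim_col B = dim_col C" "dim_col A = dim_row B"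
  shows "A * (B + C) = A * B + A * C"
  using assms by (intro mult_add_distrib_mat) (auto intro: carrier_matI)

lemma mult_smult_mat_dim:
  fixes A B :: "'a :: comm_semiring_0 mat"
  assumes "dim_col A = dim_row B"
  shows "A * (c \<cdot>\<^sub>m B) = c \<cdot>\<^sub>m (A * B)" "(c \<cdot>\<^sub>m A) * B = c \<cdot>\<^sub>m (A * B)"
  using assms by (auto intro: mult_smult_distrib mult_smult_assoc_mat carrier_matI)

lemma mult_uminus_mat_dim:
  fixes A B :: "'a :: comm_ring mat"
  assumes "dim_col A = dim_row B"
  shows "A * (- B) = - (A * B)" "(- A) * B = - (A * B)"
  using assms by auto

lemma transpose_mult_mat_dim:
  fixes A B :: "'a :: comm_semiring_0 mat"
  assumes "dim_col A = dim_row B"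
  shows "transpose_mat (A * B) = transpose_mat B * transpose_mat A"
  using assms by (intro transpose_mult) (auto intro: carrier_matI)

lemma mult_zero_mat_dim:
  assumes "dim_col A = m" "dim_row A = k"
  shows "A * 0\<^sub>m m l = (0\<^sub>m k l :: 'a :: semiring_0 mat)" "0\<^sub>m l k * A = (0\<^sub>m l m :: 'a mat)"
  using assms by (auto intro!: right_mult_zero_mat left_mult_zero_mat carrier_matI)

lemma add_zero_mat_dim:
  assumes "dim_row A = k" "dim_col A = m"
  shows "A + 0\<^sub>m k m = (A :: 'a :: monoid_add mat)" "0\<^sub>m k m + A = (A :: 'a mat)"
  using assms by auto

lemmas mat_dim_simps = mult_mat_assoc_dim add_mult_distrib_mat_dim mult_add_distrib_mat_dim
  mult_smult_mat_dim mult_uminus_mat_dim mult_zero_mat_dim add_zero_mat_dim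

lemma mult_four_block_mat_dim:
  fixes P1 P2 P3 P4 Q1 Q2 Q3 Q4 :: "'a :: semiring_0 mat"
  assumes "dim_row P1 = dim_row P2" "dim_row P3 = dim_row P4"
    "dim_col P1 = dim_col P3" "dim_col P2 = dim_col P4"
    "dim_row Q1 = dim_row Q2" "dim_row Q3 = dim_row Q4"
    "dim_col Q1 = dim_col Q3" "dim_col Q2 = dim_col Q4"
    "dim_col P1 = dim_row Q1" "dim_col P2 = dim_row Q3"
  shows "four_block_mat P1 P2 P3 P4 * four_block_mat Q1 Q2 Q3 Q4
    = four_block_mat (P1 * Q1 + P2 * Q3) (P1 * Q2 + P2 * Q4)
        (P3 * Q1 + P4 * Q3) (P3 * Q2 + P4 * Q4)"
  using assms by (intro mult_four_block_mat) (auto intro!: carrier_matI)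

section \<open>Block elimination in the bordered matrix\<close>

text \<open>\<open>E = [I, 0]\<close> and \<open>F = [0, I]\<close> are the coordinate projections
  of a direct sum. The last claim reassembles a block diagonal matrix from its two summands;
  \<open>P = I\<close> gives the decomposition of the identity.\<close>

lemma unit_block_projections:
  fixes p n :: nat
  defines "E \<equiv> mat p (p + n) (\<lambda>(i, j). if i = j then 1 else 0 :: 'a :: comm_ring_1)"
    and "F \<equiv> mat n (p + n) (\<lambda>(i, j). if j = p + i then 1 else 0 :: 'a)"
  shows "E * transpose_mat F = 0\<^sub>m p n" "E * transpose_mat E = 1\<^sub>m p"
    and "F * transpose_mat F = 1\<^sub>m n" "F * transpose_mat E = 0\<^sub>m n p"
    and "P \<in> carrier_mat n n \<Longrightarrow>
      transpose_mat E * E + transpose_mat F * (P * F) = four_block_mat (1\<^sub>m p) (0\<^sub>m p n) (0\<^sub>m n p) P"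
proof -
  show "E * transpose_mat F = 0\<^sub>m p n" "E * transpose_mat E = 1\<^sub>m p"
    "F * transpose_mat F = 1\<^sub>m n" "F * transpose_mat E = 0\<^sub>m n p"
    by (auto intro!: eq_matI simp: E_def F_def scalar_prod_def if_distrib cong: if_cong
        intro!: sum.neutral)
  assume P: "P \<in> carrier_mat n n"
  \<comment> \<open>Blocks with no rows or no columns bring \<open>E\<close> and \<open>F\<close>
    into the two-by-two form to which the block product rule applies.\<close>
  have E: "E = four_block_mat (1\<^sub>m p) (0\<^sub>m p n) (0\<^sub>m 0 p) (0\<^sub>m 0 n)"
    by (intro eq_matI) (auto simp: E_def)
  have F: "F = four_block_mat (0\<^sub>m 0 p) (0\<^sub>m 0 n) (0\<^sub>m n p) (1\<^sub>m n)"
    by (intro eq_matI) (auto simp: F_def)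
  have Et: "transpose_mat E = four_block_mat (1\<^sub>m p) (0\<^sub>m p 0) (0\<^sub>m n p) (0\<^sub>m n 0)"
    and Ft: "transpose_mat F = four_block_mat (0\<^sub>m p 0) (0\<^sub>m p n) (0\<^sub>m n 0) (1\<^sub>m n)"
    by (auto intro!: eq_matI simp: E_def F_def)
  have PF: "P * F = four_block_mat (0\<^sub>m 0 p) (0\<^sub>m 0 n) (0\<^sub>m n p) P"
  proof -
    have "P = four_block_mat (0\<^sub>m 0 0) (0\<^sub>m 0 n) (0\<^sub>m n 0) P"
      using P by (intro eq_matI) auto
    then have "P * F = four_block_mat (0\<^sub>m 0 0) (0\<^sub>m 0 n) (0\<^sub>m n 0) P * F"
      by simp
    also have "\<dots> = four_block_mat (0\<^sub>m 0 p) (0\<^sub>m 0 n) (0\<^sub>m n p) P"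
      unfolding F using P by (subst mult_four_block_mat) auto
    finally show ?thesis .
  qed
  have "transpose_mat E * E = four_block_mat (1\<^sub>m p) (0\<^sub>m p n) (0\<^sub>m n p) (0\<^sub>m n n)"
    unfolding Et unfolding E by (subst mult_four_block_mat_dim) auto
  moreover have "transpose_mat F * (P * F) = four_block_mat (0\<^sub>m p p) (0\<^sub>m p n) (0\<^sub>m n p) P"
    unfolding PF Ft using P by (subst mult_four_block_mat_dim) auto
  ultimately show "transpose_mat E * E + transpose_mat F * (P * F)
      = four_block_mat (1\<^sub>m p) (0\<^sub>m p n) (0\<^sub>m n p) P"
    using P by (auto intro!: eq_matI)
qed

text \<open>The assumption on \<open>c\<close> carries the sign: \<open>c\<close> is its own
  inverse, so scaling the border \<open>c K\<close> by \<open>c\<close> turns it into a pivot. Each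
  of the two borders supplies \<open>p\<close> pivots, hence the identity of size
  \<open>p + p\<close>.\<close>

lemma unimodular_reduction:
  fixes M K N R S :: "'a :: field poly mat"
  assumes M: "M \<in> carrier_mat (p + n) (p + n)" and K: "K \<in> carrier_mat p (p + n)"
    and N: "N \<in> carrier_mat (p + n) n" and R: "R \<in> carrier_mat (p + n) p"
    and S: "S \<in> carrier_mat n (p + n)"
    and KR: "K * R = 1\<^sub>m p" and KN: "K * N = 0\<^sub>m p n"
    and SN: "S * N = 1\<^sub>m n" and SR: "S * R = 0\<^sub>m n p"
    and c: "c * c = 1"
  obtains U V where "U \<in> carrier_mat (p + n + p) (p + n + p)" "unimodular U"
    "V \<in> carrier_mat (p + n + p) (p + n + p)" "unimodular V"
    "U * four_block_mat M (transpose_mat K) (c \<cdot>\<^sub>m K) (0\<^sub>m p p) * V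
      = diag_block_mat [1\<^sub>m (p + p), transpose_mat N * M * N]"
proof -
  define E :: "'a poly mat" where "E = mat p (p + n) (\<lambda>(i, j). if i = j then 1 else 0)"
  define F :: "'a poly mat" where "F = mat n (p + n) (\<lambda>(i, j). if j = p + i then 1 else 0)"
  define Kt Nt Rt St Et Ft where t_defs: "Kt = transpose_mat K" "Nt = transpose_mat N"
    "Rt = transpose_mat R" "St = transpose_mat S" "Et = transpose_mat E" "Ft = transpose_mat F"
  define G where "G = M * R"
  define H where "H = M * N"
  define P where "P = Nt * H"
  \<comment> \<open>After the change of basis the block rows are \<open>[Rt * G, Rt * H, I]\<close>,
    \<open>[Nt * G, P, 0]\<close> and \<open>[c I, 0, 0]\<close>. Adding the third column times
    \<open>X\<close> and \<open>Y\<close> to the first two clears the first row up to its pivot.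
    Adding \<open>T\<close> times the third row to the second clears \<open>Nt * G\<close>, because
    \<open>T\<close> times \<open>c\<close> is \<open>- (Nt * G)\<close>.\<close>
  define X where "X = - (Rt * G)"
  define Y where "Y = - (Rt * H)"
  define T where "T = - (c \<cdot>\<^sub>m (Nt * G))"
  have E: "E \<in> carrier_mat p (p + n)" and F: "F \<in> carrier_mat n (p + n)"
    by (simp_all add: E_def F_def)
  have t: "Kt \<in> carrier_mat (p + n) p" "Nt \<in> carrier_mat n (p + n)" "Rt \<in> carrier_mat p (p + n)"
    "St \<in> carrier_mat (p + n) n" "Et \<in> carrier_mat (p + n) p" "Ft \<in> carrier_mat (p + n) n"
    using K N R S E F by (auto simp: t_defs)
  have GH: "G \<in> carrier_mat (p + n) p" "H \<in> carrier_mat (p + n) n"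
    using M N R by (auto simp: G_def H_def)
  have XYT: "X \<in> carrier_mat p p" "Y \<in> carrier_mat p n" "T \<in> carrier_mat n p" "P \<in> carrier_mat n n"
    using t GH by (auto simp: X_def Y_def T_def P_def)
  note cm = M K N R S E F t GH XYT
  note dims [simp] = cm [THEN carrier_matD(1)] cm [THEN carrier_matD(2)]
  have RK: "Rt * Kt = 1\<^sub>m p" and NK: "Nt * Kt = 0\<^sub>m n p"
    and NS: "Nt * St = 1\<^sub>m n" and RS: "Rt * St = 0\<^sub>m p n"
    using KR KN SN SR unfolding t_defs by (simp_all flip: transpose_mult_mat_dim)
  have EF: "E * Ft = 0\<^sub>m p n" "E * Et = 1\<^sub>m p" "F * Ft = 1\<^sub>m n" "F * Et = 0\<^sub>m n p"
    unfolding t_defs E_def F_def by (rule unit_block_projections)+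
  have sumEF: "Et * E + Ft * (Q * F) = four_block_mat (1\<^sub>m p) (0\<^sub>m p n) (0\<^sub>m n p) Q"
    if "Q \<in> carrier_mat n n" for Q
    unfolding t_defs E_def F_def by (rule unit_block_projections) fact
  have EF1: "Et * E + Ft * F = 1\<^sub>m (p + n)"
    using sumEF [of "1\<^sub>m n"] by (auto simp: four_block_one_mat left_mult_one_mat [OF F])
  \<comment> \<open>Products are normalized to right-nested form, where a pair such as
    \<open>K * R\<close> may be followed by a further factor; each identity is therefore also needed
    in this form.\<close>
  have nested: "x * (y * z) = w * z" if "x * y = w" "dim_col x = dim_row y" "dim_col y = dim_row z"
    for x y z w :: "'a poly mat"
    using that by (metis mult_mat_assoc_dim)
  note prods = KR KN SN SR RK NK NS RS EF
  note nprods = prods [THEN nested]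
  define L where "L = four_block_mat M Kt (c \<cdot>\<^sub>m K) (0\<^sub>m p p)"
  \<comment> \<open>With \<open>W = [R, N]\<close>, these are \<open>diag(W\<^sup>T, I)\<close> and \<open>diag(W, I)\<close> composed with a permutation of the
    blocks; \<open>X\<close>, \<open>Y\<close>, \<open>T\<close> clear the blocks of \<open>W\<^sup>T M W\<close> other than \<open>P\<close>. Multiplying by \<open>E\<close> and \<open>F\<close>
    distributes the three block rows and columns over a two-by-two partition.\<close>
  define U where "U = four_block_mat (0\<^sub>m p (p + n)) (c \<cdot>\<^sub>m 1\<^sub>m p) (Et * Rt + Ft * Nt) (Ft * T)"
  define U' where "U' = four_block_mat (- (c \<cdot>\<^sub>m (St * T))) (Kt * E + St * F)
      (c \<cdot>\<^sub>m 1\<^sub>m p) (0\<^sub>m p (p + n))"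
  define V where "V = four_block_mat R (N * F) X (E + Y * F)"
  define V' where "V' = four_block_mat K (0\<^sub>m p p)
      (Ft * S + (- (Et * (X * K)) + - (Et * (Y * S)))) Et"
  have cc: "c \<cdot>\<^sub>m (c \<cdot>\<^sub>m Z) = Z" for Z
    using c by (intro eq_matI) (auto simp flip: mult.assoc)
  \<comment> \<open>Matrices of all sizes share one type, so additive cancellation holds only for
    matching dimensions. It is provided here and below in the shapes that arise when the block
    products are expanded.\<close>
  have cancel: "- Z + Z = 0\<^sub>m (dim_row Z) (dim_col Z)" for Z :: "'a poly mat"
    by (intro eq_matI) auto
  have neg0: "- 0\<^sub>m k l = (0\<^sub>m k l :: 'a poly mat)" for k l
    by (intro eq_matI) auto
  have cancel': "(P1 + - Z) + (P2 + Z) = P2 + P1"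
    if "dim_row P1 = dim_row Z" "dim_col P1 = dim_col Z"
      "dim_row P2 = dim_row Z" "dim_col P2 = dim_col Z"
    for Z P1 P2 :: "'a poly mat"
    using that by (intro eq_matI) auto
  note alg = neg0 cancel' cc cancel EF1 mat_dim_simps prods nprods
  have UU: "U * U' = four_block_mat (1\<^sub>m p) (0\<^sub>m p (p + n)) (0\<^sub>m (p + n) p) (1\<^sub>m (p + n))"
    unfolding U_def U'_def
    by (subst mult_four_block_mat_dim) (simp_all add: alg)
  have VV: "V' * V = four_block_mat (1\<^sub>m p) (0\<^sub>m p (p + n)) (0\<^sub>m (p + n) p) (1\<^sub>m (p + n))"
    unfolding V_def V'_def
    by (subst mult_four_block_mat_dim) (simp_all add: alg)
  have HF: "H * F = M * (N * F)"
    unfolding H_def by (simp add: alg)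
  have LV: "L * V = four_block_mat (G + Kt * X) (H * F + (Kt * E + Kt * (Y * F)))
      (c \<cdot>\<^sub>m 1\<^sub>m p) (0\<^sub>m p (p + n))"
    unfolding L_def V_def
    by (subst mult_four_block_mat_dim) (simp_all add: alg flip: G_def HF)
  have smult_neg: "c \<cdot>\<^sub>m (- Z) = - (c \<cdot>\<^sub>m Z)" for Z
    by (intro eq_matI) auto
  have cancel3: "Z1 + Z2 + - Z1 + - Z2 = 0\<^sub>m (dim_row Z1) (dim_col Z1)"
    if "dim_row Z1 = dim_row Z2" "dim_col Z1 = dim_col Z2" for Z1 Z2 :: "'a poly mat"
    using that by (intro eq_matI) auto
  have cancel4: "Z1 + Z2 + (Z3 + - Z1) = Z3 + Z2"
    if "dim_row Z1 = dim_row Z2" "dim_col Z1 = dim_col Z2"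
      "dim_row Z1 = dim_row Z3" "dim_col Z1 = dim_col Z3"
    for Z1 Z2 Z3 :: "'a poly mat"
    using that by (intro eq_matI) auto
  have ULV: "U * four_block_mat (G + Kt * X) (H * F + (Kt * E + Kt * (Y * F)))
      (c \<cdot>\<^sub>m 1\<^sub>m p) (0\<^sub>m p (p + n))
    = four_block_mat (1\<^sub>m p) (0\<^sub>m p (p + n)) (0\<^sub>m (p + n) p) (Et * E + Ft * (P * F))"
    unfolding U_def
    by (subst mult_four_block_mat_dim)
      (simp_all add: alg X_def Y_def T_def P_def smult_neg cancel3 cancel4)
  have carr: "U \<in> carrier_mat (p + n + p) (p + n + p)" "U' \<in> carrier_mat (p + n + p) (p + n + p)"
    "V \<in> carrier_mat (p + n + p) (p + n + p)" "V' \<in> carrier_mat (p + n + p) (p + n + p)"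
    "L \<in> carrier_mat (p + n + p) (p + n + p)"
    by (auto intro!: carrier_matI simp: U_def U'_def V_def V'_def L_def)
  have unimod: "unimodular U" "unimodular V"
    using carr UU VV
    by (auto intro: unimodular_if_mult_eq_one simp: ac_simps four_block_one_mat)
  have "U * L * V = four_block_mat (1\<^sub>m p) (0\<^sub>m p (p + n)) (0\<^sub>m (p + n) p)
      (four_block_mat (1\<^sub>m p) (0\<^sub>m p n) (0\<^sub>m n p) P)"
    using carr by (simp add: mult_mat_assoc_dim LV ULV sumEF XYT)
  also have "\<dots> = diag_block_mat [1\<^sub>m (p + p), P]"
    by (auto intro!: eq_matI simp: Let_def)
  also have "P = transpose_mat N * M * N"
    by (simp add: P_def H_def t_defs(2) [symmetric] alg)
  finally show thesis
    using carr unimod that unfolding L_def t_defs(1) by blast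
qed

section \<open>Reversal with respect to a grade\<close>

lemma coeff_rev_poly: "coeff (rev_poly g p) i = (if i \<le> g then coeff p (g - i) else 0)"
proof -
  have "coeff (rev_poly g p) i = (\<Sum>k\<le>g. if i \<le> g \<and> k = g - i then coeff p k else 0)"
    unfolding rev_poly_def coeff_sum coeff_monom by (intro sum.cong) auto
  then show ?thesis
    by simp
qed

lemma rev_poly_0 [simp]: "rev_poly g 0 = 0"
  by (simp add: rev_poly_def)

lemma rev_poly_sum: "rev_poly g (sum f I) = (\<Sum>i\<in>I. rev_poly g (f i))"
  by (rule poly_eqI) (simp add: coeff_rev_poly coeff_sum)

lemma rev_poly_smult: "rev_poly g (smult c p) = smult c (rev_poly g p)"
  by (rule poly_eqI) (simp add: coeff_rev_poly)

text \<open>\<open>reflect_poly\<close> reverses at the exact degree; the excess of the grade over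
  the degree becomes a power of the indeterminate.\<close>

lemma rev_poly_conv_reflect_poly:
  assumes "degree p \<le> g"
  shows "rev_poly g p = monom 1 (g - degree p) * reflect_poly p"
  using assms by (intro poly_eqI) (auto simp: coeff_rev_poly coeff_monom_mult coeff_reflect_poly coeff_eq_0)

text \<open>Over a field degrees of nonzero factors add, so the excesses of the grades add as well,
  and \<open>reflect_poly\<close> is multiplicative. Zero factors are treated apart because degrees
  do not add there.\<close>

lemma rev_poly_mult:
  fixes p q :: "'a :: field poly"
  assumes "degree p \<le> g" "degree q \<le> h"
  shows "rev_poly (g + h) (p * q) = rev_poly g p * rev_poly h q"
proof (cases "p = 0 \<or> q = 0")
  case False
  then have "degree (p * q) = degree p + degree q"
    by (simp add: degree_mult_eq)
  moreover have "g + h - (degree p + degree q) = (g - degree p) + (h - degree q)"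
    using assms by simp
  ultimately have "rev_poly (g + h) (p * q)
      = monom 1 ((g - degree p) + (h - degree q)) * (reflect_poly p * reflect_poly q)"
    using assms by (simp add: rev_poly_conv_reflect_poly reflect_poly_mult)
  also have "monom 1 ((g - degree p) + (h - degree q))
      = (monom 1 (g - degree p) * monom 1 (h - degree q) :: 'a poly)"
    by (simp add: mult_monom)
  finally show ?thesis
    using assms by (simp add: rev_poly_conv_reflect_poly ac_simps)
qed auto

lemma rev_poly_monom: "i \<le> g \<Longrightarrow> rev_poly g (monom c i) = monom c (g - i)"
  by (rule poly_eqI) (auto simp: coeff_rev_poly)

lemma has_gradeD: "has_grade g P \<Longrightarrow> i < dim_row P \<Longrightarrow> j < dim_col P \<Longrightarrow> degree (P $$ (i, j)) \<le> g"
  by (simp add: has_grade_def)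

lemma has_grade_transpose [simp]: "has_grade g (transpose_mat P) \<longleftrightarrow> has_grade g P"
  by (auto simp: has_grade_def)

lemma rev_mat_transpose: "rev_mat g (transpose_mat P) = transpose_mat (rev_mat g P)"
  by (auto simp: rev_mat_def)

lemma dim_rev_mat [simp]: "dim_row (rev_mat g P) = dim_row P" "dim_col (rev_mat g P) = dim_col P"
  by (simp_all add: rev_mat_def)

lemma rev_mat_smult: "rev_mat g ([:c:] \<cdot>\<^sub>m P) = [:c:] \<cdot>\<^sub>m rev_mat g P"
  by (rule eq_matI) (auto simp: rev_mat_def rev_poly_smult)

lemma rev_mat_zero: "rev_mat g (0\<^sub>m k l) = 0\<^sub>m k l"
  by (rule eq_matI) (auto simp: rev_mat_def)

lemma has_grade_mult:
  assumes "has_grade g P" "has_grade h Q" "dim_col P = dim_row Q"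
  shows "has_grade (g + h) (P * Q)"
  unfolding has_grade_def using assms
  by (auto simp: scalar_prod_def
      intro!: degree_sum_le order.trans [OF degree_mult_le] add_mono has_gradeD)

text \<open>All summands of an entry of the product are reversed at the same grade
  \<open>g + h\<close>, where reversal is additive; the claim thus reduces to products of
  entries.\<close>

lemma rev_mat_mult:
  assumes "has_grade g P" "has_grade h Q" "dim_col P = dim_row Q"
  shows "rev_mat (g + h) (P * Q) = rev_mat g P * rev_mat h Q"
proof (rule eq_matI)
  fix i j
  assume "i < dim_row (rev_mat g P * rev_mat h Q)" "j < dim_col (rev_mat g P * rev_mat h Q)"
  then show "rev_mat (g + h) (P * Q) $$ (i, j) = (rev_mat g P * rev_mat h Q) $$ (i, j)"
    using assms
    by (auto simp: rev_mat_def scalar_prod_def rev_poly_sum intro!: sum.cong rev_poly_mult has_gradeD)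
qed simp_all

section \<open>Kronecker products with an identity matrix\<close>

lemma dim_kron [simp]:
  "dim_row (kron A B) = dim_row A * dim_row B" "dim_col (kron A B) = dim_col A * dim_col B"
  by (simp_all add: kron_def)

lemma kron_index_one:
  fixes A :: "'a :: semiring_1 mat"
  assumes "i < dim_row A * n" "j < dim_col A * n"
  shows "kron A (1\<^sub>m n) $$ (i, j) = (if i mod n = j mod n then A $$ (i div n, j div n) else 0)"
proof -
  have "n > 0"
    using assms(1) by (cases n) auto
  then show ?thesis
    using assms by (simp add: kron_def)
qed

lemma transpose_kron_one: "transpose_mat (kron A (1\<^sub>m n))
  = kron (transpose_mat A) (1\<^sub>m n :: 'a :: semiring_1 mat)"
  by (rule eq_matI) (auto simp: kron_index_one less_mult_imp_div_less)

text \<open>This mixed product rule transfers the identities between the small matrices built from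
  \<open>L_mat\<close> and \<open>Lambda_mat\<close> to their Kronecker products with the
  identity.\<close>

lemma kron_one_mult:
  fixes A B :: "'a :: semiring_1 mat"
  assumes "dim_col A = dim_row B"
  shows "kron A (1\<^sub>m n) * kron B (1\<^sub>m n) = kron (A * B) (1\<^sub>m n)"
proof (rule eq_matI)
  fix i j
  assume "i < dim_row (kron (A * B) (1\<^sub>m n))" "j < dim_col (kron (A * B) (1\<^sub>m n))"
  then have i: "i < dim_row A * n" and j: "j < dim_col B * n"
    by simp_all
  then have n: "n > 0"
    by (cases n) auto
  have "(kron A (1\<^sub>m n) * kron B (1\<^sub>m n)) $$ (i, j)
      = (\<Sum>k<dim_row B * n. kron A (1\<^sub>m n) $$ (i, k) * kron B (1\<^sub>m n) $$ (k, j))"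
    using i j assms by (simp add: scalar_prod_def lessThan_atLeast0)
  \<comment> \<open>The summation index is split into runs of length \<open>n\<close>. Within a run
    only the offset \<open>i mod n\<close> contributes, and only if it equals
    \<open>j mod n\<close>.\<close>
  also have "\<dots> = (\<Sum>k<dim_row B. \<Sum>l\<in>{k * n..<k * n + n}.
      kron A (1\<^sub>m n) $$ (i, l) * kron B (1\<^sub>m n) $$ (l, j))"
    by (rule sum.nat_group [symmetric])
  also have "\<dots> = (\<Sum>k<dim_row B.
      if i mod n = j mod n then A $$ (i div n, k) * B $$ (k, j div n) else 0)"
  proof (rule sum.cong)
    fix k
    assume k: "k \<in> {..<dim_row B}"
    have "(\<Sum>l\<in>{k * n..<k * n + n}. kron A (1\<^sub>m n) $$ (i, l) * kron B (1\<^sub>m n) $$ (l, j))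
        = (\<Sum>l\<in>{0..<n}.
            kron A (1\<^sub>m n) $$ (i, l + k * n) * kron B (1\<^sub>m n) $$ (l + k * n, j))"
      using sum.shift_bounds_nat_ivl [of _ 0 "k * n" n] by (simp add: add.commute)
    also have "\<dots> = (\<Sum>l\<in>{0..<n}. if l = i mod n then
        if i mod n = j mod n then A $$ (i div n, k) * B $$ (k, j div n) else 0 else 0)"
    proof (rule sum.cong)
      fix l
      assume l: "l \<in> {0..<n}"
      have "Suc k * n \<le> dim_row B * n"
        using k by (intro mult_le_mono1) auto
      then have "l + k * n < dim_row B * n"
        using l by simp
      then show "kron A (1\<^sub>m n) $$ (i, l + k * n) * kron B (1\<^sub>m n) $$ (l + k * n, j)
        = (if l = i mod n then
        if i mod n = j mod n then A $$ (i div n, k) * B $$ (k, j div n) else 0 else 0)"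
        using i j l n assms by (auto simp: kron_index_one)
    qed simp
    also have "\<dots> = (if i mod n = j mod n then A $$ (i div n, k) * B $$ (k, j div n) else 0)"
      using n by simp
    finally show "(\<Sum>l\<in>{k * n..<k * n + n}. kron A (1\<^sub>m n) $$ (i, l) * kron B (1\<^sub>m n) $$ (l, j)) = \<dots>" .
  qed simp
  also have "\<dots> = kron (A * B) (1\<^sub>m n) $$ (i, j)"
    using i j assms
    by (auto simp: kron_index_one scalar_prod_def lessThan_atLeast0 less_mult_imp_div_less)
  finally show "(kron A (1\<^sub>m n) * kron B (1\<^sub>m n)) $$ (i, j) = kron (A * B) (1\<^sub>m n) $$ (i, j)" .
qed simp_all

lemma kron_one_one: "kron (1\<^sub>m m) (1\<^sub>m n) = (1\<^sub>m (m * n) :: 'a :: semiring_1 mat)"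
proof (rule eq_matI)
  fix i j
  assume "i < dim_row (1\<^sub>m (m * n) :: 'a mat)" "j < dim_col (1\<^sub>m (m * n) :: 'a mat)"
  then show "kron (1\<^sub>m m) (1\<^sub>m n) $$ (i, j) = (1\<^sub>m (m * n) :: 'a mat) $$ (i, j)"
    by (auto simp: kron_index_one less_mult_imp_div_less) (metis div_mult_mod_eq)
qed simp_all

lemma kron_zero_one: "kron (0\<^sub>m m k) (1\<^sub>m n) = (0\<^sub>m (m * n) (k * n) :: 'a :: semiring_1 mat)"
  by (rule eq_matI) (auto simp: kron_index_one less_mult_imp_div_less)

lemma kron_smult_one: "kron (c \<cdot>\<^sub>m A) (1\<^sub>m n) = c \<cdot>\<^sub>m (kron A (1\<^sub>m n) :: 'a :: semiring_1 mat)"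
  by (rule eq_matI) (auto simp: kron_index_one less_mult_imp_div_less)

lemma rev_mat_kron_one: "rev_mat g (kron A (1\<^sub>m n)) = kron (rev_mat g A) (1\<^sub>m n)"
  by (rule eq_matI) (auto simp: rev_mat_def kron_index_one less_mult_imp_div_less)

lemma has_grade_kron_one: "has_grade g A \<Longrightarrow> has_grade g (kron A (1\<^sub>m n))"
  by (auto simp: has_grade_def kron_index_one less_mult_imp_div_less)

section \<open>Pencils and grades of block matrices\<close>

text \<open>The matrices of linear and constant coefficients are the witnesses. Being a pencil thus
  becomes a degree bound, which passes easily through blocks, transposes and reversals.\<close>

lemma is_pencil_if_has_grade:
  assumes "has_grade 1 L"
  shows "is_pencil L"
proof -
  have deg1: "p = [:coeff p 0, coeff p 1:]" if "degree p \<le> 1" for p :: "'a poly"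
    using that by (intro poly_eqI) (auto simp: coeff_pCons coeff_eq_0 split: nat.split)
  have "L = pencil (map_mat (\<lambda>p. coeff p 1) L) (map_mat (\<lambda>p. coeff p 0) L)"
    using assms
    by (intro eq_matI) (auto simp: pencil_def has_grade_def intro!: deg1 [unfolded One_nat_def])
  then show ?thesis
    unfolding is_pencil_def by (metis map_carrier_mat carrier_matI)
qed

lemma has_grade_pencil:
  assumes "dim_row X = dim_row Y" "dim_col X = dim_col Y"
  shows "has_grade 1 (pencil X Y)"
  using assms by (auto simp: has_grade_def pencil_def)

lemma has_grade_four_block_mat:
  assumes "has_grade g M1" "has_grade g M2" "has_grade g M3" "has_grade g M4"
    and "dim_row M1 = dim_row M2" "dim_row M3 = dim_row M4"
      "dim_col M1 = dim_col M3" "dim_col M2 = dim_col M4"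
  shows "has_grade g (four_block_mat M1 M2 M3 M4)"
  using assms by (auto simp: has_grade_def)

lemma rev_mat_four_block_mat:
  assumes "dim_row M1 = dim_row M2" "dim_row M3 = dim_row M4"
      "dim_col M1 = dim_col M3" "dim_col M2 = dim_col M4"
  shows "rev_mat g (four_block_mat M1 M2 M3 M4)
    = four_block_mat (rev_mat g M1) (rev_mat g M2) (rev_mat g M3) (rev_mat g M4)"
  using assms by (auto intro!: eq_matI simp: rev_mat_def)

section \<open>Complements of \<open>L_mat\<close> and of its reversal\<close>

text \<open>Covers \<open>L_mat\<close> with \<open>a = -1\<close>, \<open>b = \<lambda>\<close> and
  its reversal with \<open>a = -\<lambda>\<close>, \<open>b = 1\<close>.\<close>

lemma upper_bidiagonal_mult_index:
  fixes a b :: "'a :: semiring_0"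
  assumes "A \<in> carrier_mat (s + 1) m" "i < s" "j < m"
  shows "(mat s (s + 1) (\<lambda>(i, j). if j = i then a else if j = i + 1 then b else 0) * A) $$ (i, j)
    = a * A $$ (i, j) + b * A $$ (i + 1, j)"
proof -
  have "(mat s (s + 1) (\<lambda>(i, j). if j = i then a else if j = i + 1 then b else 0) * A) $$ (i, j)
    = (\<Sum>k<s + 1. (if k = i then a * A $$ (k, j) else 0)
        + (if k = i + 1 then b * A $$ (k, j) else 0))"
    using assms by (auto simp: scalar_prod_def lessThan_atLeast0 intro!: sum.cong)
  also have "\<dots> = a * A $$ (i, j) + b * A $$ (i + 1, j)"
    using assms unfolding sum.distrib by simp
  finally show ?thesis .
qed

lemma dim_L_mat [simp]: "dim_row (L_mat s) = s" "dim_col (L_mat s) = s + 1"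
  by (simp_all add: L_mat_def)

lemma L_mat_mult_index:
  assumes "A \<in> carrier_mat (s + 1) m" "i < s" "j < m"
  shows "(L_mat s * A) $$ (i, j) = [:0, 1:] * A $$ (i + 1, j) - A $$ (i, j)"
  using upper_bidiagonal_mult_index [OF assms, of "-1" "[:0, 1:]"] by (simp add: L_mat_def)

text \<open>The first \<open>s\<close> columns of \<open>L_mat s\<close> form
  \<open>-(I - \<lambda> J)\<close> with \<open>J\<close> the nilpotent upper shift. The negated
  geometric series in \<open>\<lambda> J\<close> inverts this block and gives the upper rows of
  \<open>R\<close>, whose last row is zero. \<open>S\<close> selects the last coordinate, where
  \<open>Lambda_mat s\<close> has the entry 1.\<close>

lemma L_mat_complement:
  fixes s :: nat
  defines "R \<equiv> mat (s + 1) s (\<lambda>(i, j). if i \<le> j then monom (- 1) (j - i) else 0 :: 'a :: field poly)"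
    and "S \<equiv> mat 1 (s + 1) (\<lambda>(i, j). if j = s then 1 else 0 :: 'a poly)"
  shows "L_mat s * R = 1\<^sub>m s" "L_mat s * (Lambda_mat s :: 'a poly mat) = 0\<^sub>m s 1"
    and "S * Lambda_mat s = 1\<^sub>m 1" "S * R = 0\<^sub>m 1 s"
proof -
  have carrier: "R \<in> carrier_mat (s + 1) s" "Lambda_mat s \<in> carrier_mat (s + 1) 1"
    by (simp_all add: R_def Lambda_mat_def)
  show "L_mat s * R = 1\<^sub>m s"
    using carrier(1) [unfolded Suc_eq_plus1 [symmetric]]
    by (intro eq_matI)
      (auto simp: L_mat_mult_index [unfolded One_nat_def] simp del: index_mult_mat(1),
        auto simp: R_def Suc_diff_Suc minus_monom simp flip: monom_Suc)
  show "L_mat s * (Lambda_mat s :: 'a poly mat) = 0\<^sub>m s 1"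
    using carrier(2) [unfolded Suc_eq_plus1 [symmetric]]
    by (intro eq_matI)
      (auto simp: L_mat_mult_index [unfolded One_nat_def] simp del: index_mult_mat(1),
        auto simp: Lambda_mat_def Suc_diff_Suc simp flip: monom_Suc)
  show "S * Lambda_mat s = 1\<^sub>m 1" "S * R = 0\<^sub>m 1 s"
    by (auto intro!: eq_matI simp: S_def R_def Lambda_mat_def scalar_prod_def
        if_distrib [where f = "\<lambda>x. x * _"] cong: if_cong)
qed

lemma rev_mat_L_mat: "rev_mat 1 (L_mat s :: 'a :: field poly mat)
  = mat s (s + 1) (\<lambda>(i, j). if j = i then - [:0, 1:] else if j = i + 1 then 1 else 0)"
  by (intro eq_matI) (auto simp: L_mat_def rev_mat_def rev_poly_def monom_0 monom_Suc)

lemma rev_L_mat_mult_index: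
  assumes "A \<in> carrier_mat (s + 1) m" "i < s" "j < m"
  shows "(rev_mat 1 (L_mat s) * A) $$ (i, j) = A $$ (i + 1, j) - [:0, 1:] * A $$ (i, j)"
  using upper_bidiagonal_mult_index [OF assms, of "- [:0, 1:]" 1] unfolding rev_mat_L_mat by simp

lemma rev_mat_Lambda_mat: "rev_mat s (Lambda_mat s :: 'a :: field poly mat)
  = mat (s + 1) 1 (\<lambda>(i, j). monom 1 i)"
  by (intro eq_matI) (auto simp: Lambda_mat_def rev_mat_def rev_poly_monom)

text \<open>Now the last \<open>s\<close> columns form the invertible block
  \<open>I - \<lambda> J\<close> with \<open>J\<close> the lower shift. Its inverse, a geometric
  series, sits in \<open>R\<close> below a zero first row, which shifts the exponent by one; the
  guard \<open>i > j\<close> keeps the subtraction exact. \<open>S\<close> selects the first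
  coordinate, where the reversed \<open>Lambda_mat s\<close> has the entry 1.\<close>

lemma rev_L_mat_complement:
  fixes s :: nat
  defines "R \<equiv> mat (s + 1) s (\<lambda>(i, j). if i > j then monom 1 (i - 1 - j) else 0 :: 'a :: field poly)"
    and "S \<equiv> mat 1 (s + 1) (\<lambda>(i, j). if j = 0 then 1 else 0 :: 'a poly)"
  shows "rev_mat 1 (L_mat s) * R = 1\<^sub>m s"
    and "rev_mat 1 (L_mat s) * rev_mat s (Lambda_mat s :: 'a poly mat) = 0\<^sub>m s 1"
    and "S * rev_mat s (Lambda_mat s) = 1\<^sub>m 1" "S * R = 0\<^sub>m 1 s"
proof -
  have carrier: "R \<in> carrier_mat (s + 1) s" "rev_mat s (Lambda_mat s) \<in> carrier_mat (s + 1) 1"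
    by (simp_all add: R_def rev_mat_Lambda_mat)
  show "rev_mat 1 (L_mat s) * R = 1\<^sub>m s"
    using carrier(1) [unfolded Suc_eq_plus1 [symmetric]]
    by (intro eq_matI)
      (auto simp: rev_L_mat_mult_index [unfolded One_nat_def] simp del: index_mult_mat(1),
        auto simp: R_def Suc_diff_Suc minus_monom simp flip: monom_Suc)
  show "rev_mat 1 (L_mat s) * rev_mat s (Lambda_mat s :: 'a poly mat) = 0\<^sub>m s 1"
    using carrier(2) [unfolded Suc_eq_plus1 [symmetric]]
    by (intro eq_matI)
      (auto simp: rev_L_mat_mult_index [unfolded One_nat_def] simp del: index_mult_mat(1),
        auto simp: rev_mat_Lambda_mat simp flip: monom_Suc)
  show "S * rev_mat s (Lambda_mat s) = 1\<^sub>m 1" "S * R = 0\<^sub>m 1 s"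
    by (auto intro!: eq_matI simp: S_def R_def rev_mat_Lambda_mat scalar_prod_def
        if_distrib [where f = "\<lambda>x. x * _"] cong: if_cong)
qed

section \<open>From complements to strong linearizations\<close>

lemma has_grade_rev_mat: "has_grade g (rev_mat g P)"
  unfolding has_grade_def by (auto simp: rev_mat_def coeff_rev_poly intro!: degree_le)

text \<open>The pencil and its reversal both have this shape, so the elimination serves both halves
  of strong linearization.\<close>

lemma is_linearization_if_complement:
  fixes M K N R S :: "'a :: field poly mat" and c :: 'a
  assumes "M \<in> carrier_mat (p + n) (p + n)" "K \<in> carrier_mat p (p + n)"
    and "N \<in> carrier_mat (p + n) n" "R \<in> carrier_mat (p + n) p" "S \<in> carrier_mat n (p + n)"
    and "K * R = 1\<^sub>m p" "K * N = 0\<^sub>m p n" "S * N = 1\<^sub>m n" "S * R = 0\<^sub>m n p"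
    and "c * c = 1" and "has_grade 1 M" "has_grade 1 K"
  shows "is_linearization (four_block_mat M (transpose_mat K) ([:c:] \<cdot>\<^sub>m K) (0\<^sub>m p p))
    (transpose_mat N * M * N)" (is "is_linearization ?L _")
proof -
  have "has_grade 1 ?L"
    using assms by (intro has_grade_four_block_mat) (auto simp: has_grade_def)
  moreover obtain U V where "U \<in> carrier_mat (p + n + p) (p + n + p)" "unimodular U"
    "V \<in> carrier_mat (p + n + p) (p + n + p)" "unimodular V"
    "U * ?L * V = diag_block_mat [1\<^sub>m (p + p), transpose_mat N * M * N]"
    using assms(10) by (auto intro: unimodular_reduction [OF assms(1-9), of "[:c:]"] simp: one_pCons)
  moreover have "dim_row ?L = p + n + p" "dim_col ?L = p + n + p"
    using assms(1) by auto
  ultimately show ?thesis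
    unfolding is_linearization_def by (metis is_pencil_if_has_grade)
qed

theorem theorem4p4:
  fixes A B :: "'a :: field mat" and \<sigma> :: 'a and s n :: nat
  assumes "s \<ge> 1" and "n \<ge> 1"
    and "\<sigma> \<in> {1, -1}"
    and "A \<in> carrier_mat ((s + 1) * n) ((s + 1) * n)"
    and "B \<in> carrier_mat ((s + 1) * n) ((s + 1) * n)"
  shows "is_strong_linearization
    (four_block_mat
       (pencil B A)                           (kron (transpose_mat (L_mat s)) (1\<^sub>m n))
       (kron ([:\<sigma>:] \<cdot>\<^sub>m L_mat s) (1\<^sub>m n))      (0\<^sub>m (s * n) (s * n)))
    (kron (transpose_mat (Lambda_mat s)) (1\<^sub>m n) * pencil B A * kron (Lambda_mat s) (1\<^sub>m n))
    (2 * s + 1)"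
proof -
  define M where "M = pencil B A"
  define K :: "'a poly mat" where "K = kron (L_mat s) (1\<^sub>m n)"
  define N :: "'a poly mat" where "N = kron (Lambda_mat s) (1\<^sub>m n)"
  let ?L = "four_block_mat M (transpose_mat K) ([:\<sigma>:] \<cdot>\<^sub>m K) (0\<^sub>m (s * n) (s * n))"
  let ?P = "transpose_mat N * M * N"
  have dim_Lambda: "dim_row (Lambda_mat s :: 'a poly mat) = s + 1"
    "dim_col (Lambda_mat s :: 'a poly mat) = 1"
    by (simp_all add: Lambda_mat_def)
  \<comment> \<open>The size \<open>(s + 1) * n\<close> is written as \<open>p + n\<close> with
    \<open>p = s * n\<close>, the splitting used by the elimination.\<close>
  have M: "M \<in> carrier_mat (s * n + n) (s * n + n)"
    and K: "K \<in> carrier_mat (s * n) (s * n + n)" and N: "N \<in> carrier_mat (s * n + n) n"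
    using assms(4,5) by (auto simp: M_def K_def N_def pencil_def dim_Lambda intro!: carrier_matI)
  have grade_M: "has_grade 1 M"
    unfolding M_def using assms(4,5) by (intro has_grade_pencil) auto
  have grade_K: "has_grade 1 K"
    unfolding K_def by (intro has_grade_kron_one) (auto simp: has_grade_def L_mat_def)
  have grade_N: "has_grade s N"
    unfolding N_def
    by (intro has_grade_kron_one) (auto simp: has_grade_def Lambda_mat_def
        intro: order.trans [OF degree_monom_le])
  have \<sigma>: "\<sigma> * \<sigma> = 1"
    using assms(3) by auto
  \<comment> \<open>It is enough to complement the small matrix \<open>Q\<close> and the column
    \<open>v\<close>: taking Kronecker products with the identity preserves all four
    relations.\<close>
  have complement: "is_linearization
      (four_block_mat M' (transpose_mat (kron Q (1\<^sub>m n)))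
        ([:\<sigma>:] \<cdot>\<^sub>m kron Q (1\<^sub>m n)) (0\<^sub>m (s * n) (s * n)))
      (transpose_mat (kron v (1\<^sub>m n)) * M' * kron v (1\<^sub>m n))"
    if "M' \<in> carrier_mat (s * n + n) (s * n + n)" "Q \<in> carrier_mat s (s + 1)"
      "v \<in> carrier_mat (s + 1) 1"
      "R \<in> carrier_mat (s + 1) s" "S \<in> carrier_mat 1 (s + 1)"
      "Q * R = 1\<^sub>m s" "Q * v = 0\<^sub>m s 1" "S * v = 1\<^sub>m 1" "S * R = 0\<^sub>m 1 s"
      "has_grade 1 M'" "has_grade 1 Q"
    for M' Q v R S
    using that \<sigma>
    by (intro is_linearization_if_complement [where R = "kron R (1\<^sub>m n)" and S = "kron S (1\<^sub>m n)"])
      (auto simp: kron_one_mult kron_one_one kron_zero_one has_grade_kron_one intro!: carrier_matI)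
  have "is_linearization ?L ?P"
    unfolding K_def N_def
    by (rule complement [OF _ _ _ _ _ L_mat_complement])
      (use M grade_M in \<open>auto simp: Lambda_mat_def has_grade_def L_mat_def\<close>)
  moreover have "is_linearization (rev_mat 1 ?L) (rev_mat (2 * s + 1) ?P)"
  proof -
    have "rev_mat 1 ?L = four_block_mat (rev_mat 1 M) (transpose_mat (rev_mat 1 K))
        ([:\<sigma>:] \<cdot>\<^sub>m rev_mat 1 K) (0\<^sub>m (s * n) (s * n))"
      using M K
      by (subst rev_mat_four_block_mat)
        (auto simp: rev_mat_transpose rev_mat_smult rev_mat_zero)
    \<comment> \<open>The grade \<open>2 * s + 1\<close> is split along the three factors, which
      have grades \<open>s\<close>, \<open>1\<close> and \<open>s\<close>; each factor is reversed
      at its own grade.\<close>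
    moreover have "rev_mat (s + 1 + s) ?P = transpose_mat (rev_mat s N) * rev_mat 1 M * rev_mat s N"
    proof -
      have grade_Nt: "has_grade s (transpose_mat N)"
        using grade_N by simp
      have "has_grade (s + 1) (transpose_mat N * M)"
        using M N by (intro has_grade_mult grade_Nt grade_M) auto
      then have "rev_mat (s + 1 + s) ?P = rev_mat (s + 1) (transpose_mat N * M) * rev_mat s N"
        using M N by (intro rev_mat_mult grade_N) auto
      also have "rev_mat (s + 1) (transpose_mat N * M) = rev_mat s (transpose_mat N) * rev_mat 1 M"
        using M N by (intro rev_mat_mult grade_Nt grade_M) auto
      finally show ?thesis
        by (simp only: rev_mat_transpose)
    qed
    moreover have "is_linearization
      (four_block_mat (rev_mat 1 M) (transpose_mat (rev_mat 1 K))
        ([:\<sigma>:] \<cdot>\<^sub>m rev_mat 1 K) (0\<^sub>m (s * n) (s * n)))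
      (transpose_mat (rev_mat s N) * rev_mat 1 M * rev_mat s N)"
      unfolding K_def N_def rev_mat_kron_one
      by (rule complement [OF _ _ _ _ _ rev_L_mat_complement])
        (use M in \<open>auto simp: dim_Lambda has_grade_rev_mat intro!: carrier_matI simp del: One_nat_def\<close>)
    ultimately show ?thesis
      by (simp add: mult_2)
  qed
  moreover have "has_grade (2 * s + 1) ?P"
    using has_grade_mult [OF has_grade_mult [of s "transpose_mat N" 1 M] grade_N] M N grade_M grade_N
    by (simp add: mult_2)
  ultimately have "is_strong_linearization ?L ?P (2 * s + 1)"
    by (simp add: is_strong_linearization_def)
  then show ?thesis
    by (simp add: M_def K_def N_def transpose_kron_one kron_smult_one)
qed

end
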